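(* Let $f,g,c$ satisfy the standing assumption on the composite problem (P), $\min_x\Phi(x)=f(x)+g(c(x))$. Let $\hat y\in\mathbb R^m$, $\mu>0$, and $\varepsilon\ge0$ be fixed, and let $\bar x\in\mathbb R^n$ be chosen such that $L_\mu(\bar x,\hat y)\le\inf_x L_\mu(x,\hat y)+\varepsilon$. Set $\bar z=\operatorname{prox}_{\mu g}(c(\bar x)+\mu\hat y)$ and $\bar y=\hat y+\mu^{-1}(c(\bar x)-\bar z)$. Then $\bar y\in\operatorname{prox}^{\varepsilon}_{-\frac1\mu d}(\hat y)$, i.e. $$\left\|\bar y-\operatorname{prox}_{-\frac1\mu d}(\hat y)\right\|\le\sqrt{2\varepsilon/\mu},$$ where $d$ is the Lagrange dual function of (P).
   Context: Spaces $\mathbb R^n,\mathbb R^m$ carry the Euclidean inner product $\langle\cdot,\cdot\rangle$ and norm $\|\cdot\|$; $\overline{\mathbb R}=\mathbb R\cup\{+\infty\}$. For a proper lsc convex $g:\mathbb R^m\to\overline{\mathbb R}$, the horizon is $\operatorname{hzn} g=\{v\in\mathbb R^m : g(z+v)\le g(z)\ \forall z\in\operatorname{dom} g\}$ and $g^*$ is the convex conjugate. Standing assumption: $f:\mathbb R^n\to\mathbb R$ is continuously differentiable and convex; $g:\mathbb R^m\to\overline{\mathbb R}$ is proper, lsc, convex; $c:\mathbb R^n\to\mathbb R^m$ is continuously differentiable and $(-\operatorname{hzn} g)$-convex, i.e. $c(\lambda x+(1-\lambda)x')-\lambda c(x)-(1-\lambda)c(x')\in\operatorname{hzn} g$ for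 all $x,x'\in\mathbb R^n$, $\lambda\in[0,1]$; (P) is feasible and possesses a minimizer. Lagrangian: $L(x,y)=f(x)+\langle y,c(x)\rangle-g^*(y)\in\mathbb R\cup\{-\infty\}$. Dual function: $d(y)=\inf_xL(x,y)\in\mathbb R\cup\{-\infty\}$. Augmented Lagrangian for $\mu>0$: $L_\mu(x,y)=f(x)+g^\mu(c(x)+\mu y)-\frac\mu2\|y\|^2$, where $g^\mu(z)=\inf_w\{g(w)+\frac1{2\mu}\|w-z\|^2\}$. For proper lsc convex $\varphi$, $\operatorname{prox}_\varphi(z)$ is the unique minimizer of $w\mapsto\varphi(w)+\frac12\|w-z\|^2$, and for $\gamma>0$, $\varepsilon\ge0$ the inexact proximal mapping is $\operatorname{prox}^\varepsilon_{\gamma\varphi}(z)=\{y:\|y-\operatorname{prox}_{\gamma\varphi}(z)\|\le\sqrt{2\gamma\varepsilon}\}$ (used with $\varphi=-d$, $\gamma=1/\mu$). *)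

theory Defs
  imports "HOL-Analysis.Analysis"
begin

text \<open>
  Extended-valued functions have type \<open>'a \<Rightarrow> ereal\<close>.  In \<open>ereal\<close> we have \<open>0 * \<infinity> = 0\<close> and
  \<open>\<infinity> - \<infinity> = \<infinity>\<close>; the latter case never arises below when the function \<open>g\<close> is proper.
\<close>

definition proper_fun :: "('a \<Rightarrow> ereal) \<Rightarrow> bool" where
  "proper_fun g \<longleftrightarrow> (\<forall>z. g z \<noteq> -\<infinity>) \<and> (\<exists>z. g z \<noteq> \<infinity>)"

definition lsc_fun :: "('a::topological_space \<Rightarrow> ereal) \<Rightarrow> bool" where
  "lsc_fun g \<longleftrightarrow> (\<forall>z. g z \<le> Liminf (at z) g)"

text \<open>Intended for functions that never take the value \<open>-\<infinity>\<close>.\<close>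

definition convex_fun :: "('a::real_vector \<Rightarrow> ereal) \<Rightarrow> bool" where
  "convex_fun g \<longleftrightarrow> (\<forall>z z'. \<forall>t\<in>{0..1}.
     g (t *\<^sub>R z + (1 - t) *\<^sub>R z') \<le> ereal t * g z + ereal (1 - t) * g z')"

definition edom :: "('a \<Rightarrow> ereal) \<Rightarrow> 'a set" where
  "edom g = {z. g z < \<infinity>}"

definition hzn :: "('a::real_vector \<Rightarrow> ereal) \<Rightarrow> 'a set" where
  "hzn g = {v. \<forall>z\<in>edom g. g (z + v) \<le> g z}"

text \<open>The convention for \<open>K\<close>-convexity is that the convexity gap
  \<open>t c(x) + (1 - t) c(x') - c(t x + (1 - t) x')\<close> lies in \<open>K\<close>; it is used with \<open>K = - hzn g\<close>.\<close>

definition cone_convex :: "'b::real_vector set \<Rightarrow> ('a::real_vector \<Rightarrow> 'b) \<Rightarrow> bool" where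
  "cone_convex K c \<longleftrightarrow> (\<forall>x x'. \<forall>t\<in>{0..1}.
     t *\<^sub>R c x + (1 - t) *\<^sub>R c x' - c (t *\<^sub>R x + (1 - t) *\<^sub>R x') \<in> K)"

text \<open>Continuity of the derivative is with respect to the operator norm.\<close>

definition continuously_differentiable ::
    "('a::real_normed_vector \<Rightarrow> 'b::real_normed_vector) \<Rightarrow> bool" where
  "continuously_differentiable h \<longleftrightarrow>
     (\<exists>h' :: 'a \<Rightarrow> 'a \<Rightarrow>\<^sub>L 'b.
        (\<forall>x. (h has_derivative blinfun_apply (h' x)) (at x)) \<and> continuous_on UNIV h')"

definition conj_fun :: "('a::real_inner \<Rightarrow> ereal) \<Rightarrow> 'a \<Rightarrow> ereal" where
  "conj_fun g y = (SUP z. ereal (y \<bullet> z) - g z)"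

definition moreau_env :: "real \<Rightarrow> ('a::real_normed_vector \<Rightarrow> ereal) \<Rightarrow> 'a \<Rightarrow> ereal" where
  "moreau_env \<mu> g z = (INF w. g w + ereal (1 / (2 * \<mu>) * (norm (w - z))\<^sup>2))"

definition Phi :: "('a \<Rightarrow> real) \<Rightarrow> ('b \<Rightarrow> ereal) \<Rightarrow> ('a \<Rightarrow> 'b) \<Rightarrow> 'a \<Rightarrow> ereal" where
  "Phi f g c x = ereal (f x) + g (c x)"

definition Lagr :: "('a \<Rightarrow> real) \<Rightarrow> ('b::real_inner \<Rightarrow> ereal) \<Rightarrow> ('a \<Rightarrow> 'b) \<Rightarrow> 'a \<Rightarrow> 'b \<Rightarrow> ereal" where
  "Lagr f g c x y = ereal (f x) + ereal (y \<bullet> c x) - conj_fun g y"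

definition dual_fun :: "('a \<Rightarrow> real) \<Rightarrow> ('b::real_inner \<Rightarrow> ereal) \<Rightarrow> ('a \<Rightarrow> 'b) \<Rightarrow> 'b \<Rightarrow> ereal" where
  "dual_fun f g c y = (INF x. Lagr f g c x y)"

definition aug_Lagr ::
    "real \<Rightarrow> ('a \<Rightarrow> real) \<Rightarrow> ('b::real_normed_vector \<Rightarrow> ereal) \<Rightarrow> ('a \<Rightarrow> 'b) \<Rightarrow> 'a \<Rightarrow> 'b \<Rightarrow> ereal" where
  "aug_Lagr \<mu> f g c x y =
     ereal (f x) + moreau_env \<mu> g (c x + \<mu> *\<^sub>R y) - ereal (\<mu> / 2 * (norm y)\<^sup>2)"

text \<open>The value is unspecified unless the minimizer exists and is unique, as it does for
  proper, lower semicontinuous, convex \<open>\<phi>\<close>.\<close>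

definition prox :: "('a::real_normed_vector \<Rightarrow> ereal) \<Rightarrow> 'a \<Rightarrow> 'a" where
  "prox \<phi> z = (THE w. \<forall>v. \<phi> w + ereal (1 / 2 * (norm (w - z))\<^sup>2)
                            \<le> \<phi> v + ereal (1 / 2 * (norm (v - z))\<^sup>2))"

text \<open>The set denoted \<open>prox\<^sup>\<epsilon>\<close> of \<open>\<gamma> \<phi>\<close>; the scaling \<open>\<gamma>\<close> also enters the radius.\<close>

definition inexact_prox ::
    "real \<Rightarrow> ('a::real_normed_vector \<Rightarrow> ereal) \<Rightarrow> real \<Rightarrow> 'a \<Rightarrow> 'a set" where
  "inexact_prox \<gamma> \<phi> \<epsilon> z = {y. norm (y - prox (\<lambda>w. ereal \<gamma> * \<phi> w) z) \<le> sqrt (2 * \<gamma> * \<epsilon>)}"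

end

theory Submission
  imports Defs
begin

text \<open>
  Let \<open>p(u) = inf\<^sub>x f(x) + g(c(x) + u)\<close> be the perturbation function, which is convex by the
  \<open>(- hzn g)\<close>-convexity of \<open>c\<close>, and satisfies \<open>d(y) = inf\<^sub>u p(u) - y \<bullet> u\<close>.  Up to a constant,
  minimizing the augmented Lagrangian over \<open>x\<close> is minimizing the strongly convex function
  \<open>\<psi>(u) = p(u) + 1/(2 \<mu>) |u - \<mu> yhat|\<^sup>2\<close> over \<open>u\<close>.  If \<open>u*\<close> is the minimizer of its closure, then
  \<open>y* = yhat - u*/\<mu>\<close> is a subgradient of the closure of \<open>p\<close> at \<open>u*\<close>, and is the proximal point
  of the dual problem.  Now \<open>ybar = yhat - ubar/\<mu>\<close> where \<open>ubar = zbar - c(xbar)\<close> minimizes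
  \<open>\<psi>\<close> up to \<open>\<epsilon>\<close>, so strong convexity gives \<open>|ubar - u*|\<^sup>2 \<le> 2 \<mu> \<epsilon>\<close>.

  The dual function may be identically \<open>-\<infinity>\<close> under the standing assumptions alone.  This is
  excluded by the \<open>\<epsilon>\<close>-optimality of \<open>xbar\<close>: the augmented Lagrangian is finite at \<open>xbar\<close>, so its
  infimum is not \<open>-\<infinity>\<close>.
\<close>

section \<open>Strong convexity and proximal minimizers\<close>

lemma quadratic_midpoint_identity:
  fixes u v w :: "'a::real_inner"
  shows "(norm (t *\<^sub>R u + (1 - t) *\<^sub>R v - w))\<^sup>2 =
    t * (norm (u - w))\<^sup>2 + (1 - t) * (norm (v - w))\<^sup>2 - t * (1 - t) * (norm (u - v))\<^sup>2"
  unfolding power2_norm_eq_inner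
  by (simp add: inner_diff_left inner_diff_right inner_add_left inner_add_right inner_commute
      algebra_simps)

text \<open>\<open>Q\<close> is strongly convex in the first component and affine in the second.
  Comparison with midpoints makes a minimizing sequence converge. Stated for a set, this covers both
  the epigraph of \<open>g\<close> and the closed epigraph of the perturbation function.\<close>

lemma convex_set_proximal_minimizer:
  fixes C :: "('a::euclidean_space \<times> real) set" and w :: 'a and a :: real
  defines "Q \<equiv> \<lambda>q. snd q + a * (norm (fst q - w))\<^sup>2"
  assumes "closed C" "convex C" "C \<noteq> {}" "a > 0" and lower: "\<And>q. q \<in> C \<Longrightarrow> M \<le> Q q"
  obtains p where "p \<in> C" "\<And>q. q \<in> C \<Longrightarrow> Q p + a * (norm (fst q - fst p))\<^sup>2 \<le> Q q"
proof -
  have Q_comb: "Q (t *\<^sub>R p + (1 - t) *\<^sub>R q) =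
      t * Q p + (1 - t) * Q q - a * (t * (1 - t)) * (norm (fst p - fst q))\<^sup>2" for t p q
    unfolding Q_def fst_add fst_scaleR snd_add snd_scaleR quadratic_midpoint_identity
    by (simp add: algebra_simps)
  have bdd: "bdd_below (Q ` C)"
    using lower unfolding bdd_below_def by blast
  define m where "m = Inf (Q ` C)"
  have m_le: "m \<le> Q q" if "q \<in> C" for q
    unfolding m_def using bdd that by (auto intro: cInf_lower)
  have "\<exists>q\<in>C. Q q < m + 1 / real (Suc k)" for k
  proof -
    have "Inf (Q ` C) < m + 1 / real (Suc k)"
      by (simp add: m_def)
    then show ?thesis
      using cInf_less_iff[of "Q ` C"] bdd \<open>C \<noteq> {}\<close> by auto
  qed
  then obtain s where s: "\<And>k. s k \<in> C" "\<And>k. Q (s k) < m + 1 / real (Suc k)"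
    by metis
  \<comment> \<open>The midpoint of two near-minimizers still has value at least \<open>m\<close>,
    which leaves little room for the strong convexity term.\<close>
  have gap: "a * (norm (fst (s k) - fst (s l)))\<^sup>2 \<le> 2 * (1 / real (Suc k)) + 2 * (1 / real (Suc l))" for k l
  proof -
    have "(1/2) *\<^sub>R s k + (1 - 1/2) *\<^sub>R s l \<in> C"
      using \<open>convex C\<close> s(1) by (intro convexD) auto
    from m_le[OF this]
    have "4 * m \<le> 2 * Q (s k) + 2 * Q (s l) - a * (norm (fst (s k) - fst (s l)))\<^sup>2"
      unfolding Q_comb by (simp add: field_simps)
    then show ?thesis
      using s(2)[of k] s(2)[of l] by linarith
  qed
  \<comment> \<open>Only the first components are controlled by strong convexity; the second ones converge
    because the values of \<open>Q\<close> do.\<close>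
  have "Cauchy (\<lambda>k. fst (s k))"
  proof (rule metric_CauchyI)
    fix e :: real assume "e > 0"
    then obtain N where N: "1 / real (Suc N) < a * e\<^sup>2 / 4"
      using nat_approx_posE[of "a * e\<^sup>2 / 4"] \<open>a > 0\<close> by (metis divide_pos_pos mult_pos_pos zero_less_numeral zero_less_power)
    have "dist (fst (s k)) (fst (s l)) < e" if "k \<ge> N" "l \<ge> N" for k l
    proof -
      have "1 / real (Suc k) \<le> 1 / real (Suc N)" "1 / real (Suc l) \<le> 1 / real (Suc N)"
        using that by (auto intro!: divide_left_mono)
      then have "1 / real (Suc k) + 1 / real (Suc l) < a * e\<^sup>2 / 2"
        using N by linarith
      then have "a * (norm (fst (s k) - fst (s l)))\<^sup>2 < a * e\<^sup>2"
        using gap[of k l] by linarith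
      then have "(norm (fst (s k) - fst (s l)))\<^sup>2 < e\<^sup>2"
        using \<open>a > 0\<close> by simp
      then show ?thesis
        using \<open>e > 0\<close> by (simp add: dist_norm power_less_imp_less_base)
    qed
    then show "\<exists>N. \<forall>k\<ge>N. \<forall>l\<ge>N. dist (fst (s k)) (fst (s l)) < e"
      by blast
  qed
  then obtain u where u: "(\<lambda>k. fst (s k)) \<longlonglongrightarrow> u"
    using Cauchy_convergent convergent_def by blast
  have "(\<lambda>k. Q (s k)) \<longlonglongrightarrow> m"
  proof (rule tendsto_sandwich[of "\<lambda>_. m" _ _ "\<lambda>k. m + 1 / real (Suc k)"])
    show "(\<lambda>k. m + 1 / real (Suc k)) \<longlonglongrightarrow> m"
      using tendsto_add[OF tendsto_const LIMSEQ_inverse_real_of_nat, of m] by (simp add: inverse_eq_divide)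
    show "\<forall>\<^sub>F k in sequentially. m \<le> Q (s k)"
      using m_le s(1) by (intro always_eventually) blast
    show "\<forall>\<^sub>F k in sequentially. Q (s k) \<le> m + 1 / real (Suc k)"
      using s(2) by (intro always_eventually) (blast intro: less_imp_le)
  qed simp
  then have "(\<lambda>k. Q (s k) - a * (norm (fst (s k) - w))\<^sup>2) \<longlonglongrightarrow> m - a * (norm (u - w))\<^sup>2"
    by (intro tendsto_intros u)
  then have r: "(\<lambda>k. snd (s k)) \<longlonglongrightarrow> m - a * (norm (u - w))\<^sup>2"
    by (simp add: Q_def)
  define p where "p = (u, m - a * (norm (u - w))\<^sup>2)"
  have "s \<longlonglongrightarrow> p"
    using tendsto_Pair[OF u r] by (simp add: p_def)
  then have "p \<in> C"
    using \<open>closed C\<close> s(1) closed_sequentially by blast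
  have Qp: "Q p = m"
    by (simp add: Q_def p_def)
  show ?thesis
  proof
    show "p \<in> C" by fact
    fix q assume "q \<in> C"
    \<comment> \<open>Quadratic growth: compare \<open>p\<close> with a point at fraction
      \<open>t\<close> of the way to \<open>q\<close>, divide by \<open>t\<close>, and later let
      \<open>t\<close> tend to 0 from the right.\<close>
    have "a * (norm (fst q - fst p))\<^sup>2 * (1 - t) \<le> Q q - Q p" if "0 < t" "t < 1" for t
    proof -
      have "t *\<^sub>R q + (1 - t) *\<^sub>R p \<in> C"
        using \<open>convex C\<close> \<open>p \<in> C\<close> \<open>q \<in> C\<close> that by (intro convexD) auto
      from m_le[OF this] have "t * (a * (norm (fst q - fst p))\<^sup>2 * (1 - t)) \<le> t * (Q q - Q p)"
        unfolding Q_comb Qp by (simp add: algebra_simps)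
      then show ?thesis
        using that by simp
    qed
    then have "eventually (\<lambda>t. a * (norm (fst q - fst p))\<^sup>2 * (1 - t) \<le> Q q - Q p) (at_right 0)"
      unfolding eventually_at_right_field by (intro exI[of _ 1]) auto
    moreover have "((\<lambda>t. a * (norm (fst q - fst p))\<^sup>2 * (1 - t)) \<longlongrightarrow> a * (norm (fst q - fst p))\<^sup>2 * (1 - 0)) (at_right 0)"
      by (intro tendsto_intros)
    ultimately have "a * (norm (fst q - fst p))\<^sup>2 * (1 - 0) \<le> Q q - Q p"
      using tendsto_upperbound trivial_limit_at_right_real by blast
    then show "Q p + a * (norm (fst q - fst p))\<^sup>2 \<le> Q q"
      by simp
  qed
qed

text \<open>Since \<open>prox\<close> is a definite description, uniqueness is needed too: at a
  second minimizer the growth term must vanish, once the finite value \<open>\<phi> w\<close> is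
  cancelled.\<close>

lemma prox_eqI:
  assumes fin: "\<bar>\<phi> w\<bar> \<noteq> \<infinity>"
    and min: "\<And>v. \<phi> w + ereal (1 / 2 * (norm (w - z))\<^sup>2 + 1 / 2 * (norm (v - w))\<^sup>2)
                  \<le> \<phi> v + ereal (1 / 2 * (norm (v - z))\<^sup>2)"
  shows "prox \<phi> z = w"
  unfolding prox_def
proof (rule the_equality)
  have "\<phi> w + ereal (1 / 2 * (norm (w - z))\<^sup>2)
      \<le> \<phi> w + ereal (1 / 2 * (norm (w - z))\<^sup>2 + 1 / 2 * (norm (v - w))\<^sup>2)" for v
    by (intro add_left_mono) simp
  then show "\<forall>v. \<phi> w + ereal (1 / 2 * (norm (w - z))\<^sup>2) \<le> \<phi> v + ereal (1 / 2 * (norm (v - z))\<^sup>2)"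
    using min order_trans by blast
  fix w'
  assume "\<forall>v. \<phi> w' + ereal (1 / 2 * (norm (w' - z))\<^sup>2) \<le> \<phi> v + ereal (1 / 2 * (norm (v - z))\<^sup>2)"
  then have "\<phi> w + ereal (1 / 2 * (norm (w - z))\<^sup>2 + 1 / 2 * (norm (w' - w))\<^sup>2)
      \<le> \<phi> w + ereal (1 / 2 * (norm (w - z))\<^sup>2)"
    using min order_trans by blast
  then show "w' = w"
    using fin by (cases "\<phi> w") auto
qed

section \<open>Epigraphs, affine minorants and the proximal point of \<open>g\<close>\<close>

lemma closed_epigraph_lsc:
  fixes g :: "'a::metric_space \<Rightarrow> ereal"
  assumes "lsc_fun g"
  shows "closed {q :: 'a \<times> real. g (fst q) \<le> ereal (snd q)}"
proof -
  have "\<forall>s l. (\<forall>n. s n \<in> {q :: 'a \<times> real. g (fst q) \<le> ereal (snd q)}) \<and> s \<longlonglongrightarrow> l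
      \<longrightarrow> l \<in> {q. g (fst q) \<le> ereal (snd q)}"
  proof (intro allI impI)
    fix s and l :: "'a \<times> real"
    assume "(\<forall>n. s n \<in> {q. g (fst q) \<le> ereal (snd q)}) \<and> s \<longlonglongrightarrow> l"
    then have mem: "\<And>n. g (fst (s n)) \<le> ereal (snd (s n))" and lim: "s \<longlonglongrightarrow> l"
      by auto
    show "l \<in> {q. g (fst q) \<le> ereal (snd q)}"
    proof (rule ccontr)
      assume "l \<notin> {q. g (fst q) \<le> ereal (snd q)}"
      then have "ereal (snd l) < g (fst l)"
        by simp
      then obtain b where b: "snd l < b" "ereal b < g (fst l)"
        using ereal_dense2 by (metis less_ereal.simps(1))
      have "ereal b < Liminf (at (fst l)) g"
        using b(2) assms by (auto simp: lsc_fun_def intro: less_le_trans)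
      then have "eventually (\<lambda>z. ereal b < g z) (at (fst l))"
        by (rule less_LiminfD)
      \<comment> \<open>The sequence may hit its limit, which \<open>at\<close> excludes; the bound
        at the limit itself is \<open>b(2)\<close>.\<close>
      then have "eventually (\<lambda>z. ereal b < g z) (nhds (fst l))"
        using b(2) by (auto simp: eventually_nhds_conv_at)
      then have "eventually (\<lambda>n. ereal b < g (fst (s n))) sequentially"
        using tendsto_fst[OF lim] unfolding filterlim_iff by blast
      moreover have "eventually (\<lambda>n. snd (s n) < b) sequentially"
        using tendsto_snd[OF lim] b(1) by (simp add: order_tendstoD)
      ultimately have "eventually (\<lambda>n. False) sequentially"
      proof eventually_elim
        case (elim n)
        then show False using mem[of n] by (metis ereal_less_eq(3) leD order.strict_trans2 less_imp_le)
      qed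
      then show False by simp
    qed
  qed
  then show ?thesis
    by (simp only: closed_sequential_limits)
qed

lemma proper_fun_cases:
  assumes "proper_fun g"
  obtains "g z = \<infinity>" | r where "g z = ereal r"
  using assms by (cases "g z") (auto simp: proper_fun_def)

lemma convex_fun_combination_le:
  assumes "convex_fun g" "0 \<le> t" "t \<le> 1" "g z \<le> ereal r" "g z' \<le> ereal r'"
  shows "g (t *\<^sub>R z + (1 - t) *\<^sub>R z') \<le> ereal (t * r + (1 - t) * r')"
proof -
  have "g (t *\<^sub>R z + (1 - t) *\<^sub>R z') \<le> ereal t * g z + ereal (1 - t) * g z'"
    using assms by (auto simp: convex_fun_def)
  also have "\<dots> \<le> ereal t * ereal r + ereal (1 - t) * ereal r'"
    using assms by (intro add_mono ereal_mult_left_mono) auto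
  finally show ?thesis by simp
qed

lemma convex_epigraph:
  assumes "convex_fun g"
  shows "convex {q. g (fst q) \<le> ereal (snd q)}"
proof (rule convexI)
  fix p q and s t :: real
  assume "p \<in> {q. g (fst q) \<le> ereal (snd q)}" "q \<in> {q. g (fst q) \<le> ereal (snd q)}"
    and "0 \<le> s" "0 \<le> t" "s + t = 1"
  moreover from this have "t = 1 - s" "s \<le> 1"
    by auto
  ultimately show "s *\<^sub>R p + t *\<^sub>R q \<in> {q. g (fst q) \<le> ereal (snd q)}"
    using convex_fun_combination_le[OF assms, of s "fst p" "snd p" "fst q" "snd q"]
    by (simp del: diff_add_cancel)
qed

text \<open>Separate a point one unit below the graph from the closed convex epigraph. The point of
  the graph above it lies on the other side, so the hyperplane is not vertical and can be solved for
  the last coordinate.\<close>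

lemma proper_lsc_convex_affine_minorant:
  fixes g :: "'a::euclidean_space \<Rightarrow> ereal"
  assumes "proper_fun g" "lsc_fun g" "convex_fun g"
  obtains b \<beta> where "\<And>z. ereal (b \<bullet> z + \<beta>) \<le> g z"
proof -
  let ?E = "{q :: 'a \<times> real. g (fst q) \<le> ereal (snd q)}"
  obtain z0 r0 where z0: "g z0 = ereal r0"
    using assms(1) by (metis proper_fun_cases proper_fun_def)
  have "(z0, r0 - 1) \<notin> ?E"
    by (simp add: z0)
  then obtain n h where nh: "n \<bullet> (z0, r0 - 1) < h" "\<And>q. q \<in> ?E \<Longrightarrow> h < n \<bullet> q"
    using separating_hyperplane_closed_point[of ?E "(z0, r0 - 1)"] closed_epigraph_lsc[OF assms(2)]
      convex_epigraph[OF assms(3)] by blast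
  obtain n1 n2 where n: "n = (n1, n2)"
    by fastforce
  have "h < n \<bullet> (z0, r0)"
    by (rule nh(2)) (simp add: z0)
  then have "n2 > 0"
    using nh(1) by (simp add: n algebra_simps)
  have "ereal ((- n1 /\<^sub>R n2) \<bullet> z + h / n2) \<le> g z" for z
    using assms(1)
  proof (cases rule: proper_fun_cases[of _ z])
    case (2 r)
    then have "h < n \<bullet> (z, r)"
      by (intro nh(2)) simp
    then show ?thesis
      using \<open>n2 > 0\<close> by (simp add: 2 n field_simps)
  qed simp
  then show ?thesis
    by (rule that)
qed

lemma affine_plus_square_bounded_below:
  fixes b w z :: "'a::real_inner"
  assumes "a > 0"
  shows "b \<bullet> w - (norm b)\<^sup>2 / (4 * a) \<le> b \<bullet> z + a * (norm (z - w))\<^sup>2"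
proof -
  \<comment> \<open>Complete the square.\<close>
  have "0 \<le> a * (norm (z - w + b /\<^sub>R (2 * a)))\<^sup>2"
    using assms by simp
  also have "\<dots> = a * (norm (z - w))\<^sup>2 + b \<bullet> z - b \<bullet> w + (norm b)\<^sup>2 / (4 * a)"
    using assms unfolding power2_norm_eq_inner
    by (simp add: inner_add_left inner_add_right inner_diff_left inner_diff_right inner_commute field_simps)
  finally show ?thesis by simp
qed

text \<open>The objectives of \<open>prox\<close> and \<open>moreau_env\<close> differ by the factor
  \<open>\<mu>\<close>, so both are minimized at the same point, found on the epigraph of
  \<open>g\<close>. The affine minorant supplies the lower bound required there.\<close>

lemma prox_minimizes:
  fixes g :: "'a::euclidean_space \<Rightarrow> ereal"
  assumes g: "proper_fun g" "lsc_fun g" "convex_fun g" and "\<mu> > 0"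
  obtains r where "g (prox (\<lambda>w. ereal \<mu> * g w) z) = ereal r"
    and "moreau_env \<mu> g z = ereal (r + 1 / (2 * \<mu>) * (norm (prox (\<lambda>w. ereal \<mu> * g w) z - z))\<^sup>2)"
proof -
  let ?E = "{q :: 'a \<times> real. g (fst q) \<le> ereal (snd q)}"
  let ?a = "1 / (2 * \<mu>)"
  have a: "?a > 0"
    using \<open>\<mu> > 0\<close> by simp
  obtain b \<beta> where minorant: "\<And>z. ereal (b \<bullet> z + \<beta>) \<le> g z"
    using proper_lsc_convex_affine_minorant[OF g] by blast
  have "b \<bullet> z - (norm b)\<^sup>2 / (4 * ?a) + \<beta> \<le> snd q + ?a * (norm (fst q - z))\<^sup>2" if "q \<in> ?E" for q
  proof -
    have "ereal (b \<bullet> fst q + \<beta>) \<le> ereal (snd q)"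
      using minorant[of "fst q"] that order_trans by blast
    then show ?thesis
      using affine_plus_square_bounded_below[OF a, of b z "fst q"] by simp
  qed
  moreover obtain z0 r0 where "g z0 = ereal r0"
    using g(1) by (metis proper_fun_cases proper_fun_def)
  then have "(z0, r0) \<in> ?E" by simp
  then have "?E \<noteq> {}" by blast
  ultimately obtain p :: "'a \<times> real" where p: "p \<in> ?E" and
    min: "\<And>q. q \<in> ?E \<Longrightarrow> snd p + ?a * (norm (fst p - z))\<^sup>2 + ?a * (norm (fst q - fst p))\<^sup>2
        \<le> snd q + ?a * (norm (fst q - z))\<^sup>2"
    using convex_set_proximal_minimizer[OF closed_epigraph_lsc[OF g(2)] convex_epigraph[OF g(3)] _ a,
        where w = z and M = "b \<bullet> z - (norm b)\<^sup>2 / (4 * ?a) + \<beta>"]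
    by blast
  define w where "w = fst p"
  obtain r where r: "g w = ereal r"
    using g(1)
  proof (cases rule: proper_fun_cases[of _ w])
    case 1
    then show ?thesis using p by (simp add: w_def)
  qed
  \<comment> \<open>A point of the epigraph may lie above the graph; passing to the true value
    \<open>r\<close> only lowers the left side of \<open>min\<close>.\<close>
  have "r \<le> snd p"
    using p r by (simp add: w_def)
  have min': "r + ?a * (norm (w - z))\<^sup>2 + ?a * (norm (v - w))\<^sup>2 \<le> r' + ?a * (norm (v - z))\<^sup>2"
    if "g v = ereal r'" for v r'
    using min[of "(v, r')"] \<open>r \<le> snd p\<close> that by (simp add: w_def)
  have prox: "prox (\<lambda>w. ereal \<mu> * g w) z = w"
  proof (rule prox_eqI)
    show "\<bar>ereal \<mu> * g w\<bar> \<noteq> \<infinity>"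
      by (simp add: r)
    show "ereal \<mu> * g w + ereal (1 / 2 * (norm (w - z))\<^sup>2 + 1 / 2 * (norm (v - w))\<^sup>2)
        \<le> ereal \<mu> * g v + ereal (1 / 2 * (norm (v - z))\<^sup>2)" for v
      using g(1)
    proof (cases rule: proper_fun_cases[of _ v])
      case 1
      then show ?thesis using \<open>\<mu> > 0\<close> by simp
    next
      case (2 r')
      have "\<mu> * (r + ?a * (norm (w - z))\<^sup>2 + ?a * (norm (v - w))\<^sup>2) \<le> \<mu> * (r' + ?a * (norm (v - z))\<^sup>2)"
        using min'[OF 2] \<open>\<mu> > 0\<close> by (intro mult_left_mono) auto
      then show ?thesis
        using \<open>\<mu> > 0\<close> by (simp add: r 2 distrib_left)
    qed
  qed
  have "moreau_env \<mu> g z = g w + ereal (?a * (norm (w - z))\<^sup>2)"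
    unfolding moreau_env_def
  proof (rule antisym)
    show "g w + ereal (?a * (norm (w - z))\<^sup>2) \<le> (INF v. g v + ereal (?a * (norm (v - z))\<^sup>2))"
    proof (rule INF_greatest)
      fix v
      show "g w + ereal (?a * (norm (w - z))\<^sup>2) \<le> g v + ereal (?a * (norm (v - z))\<^sup>2)"
        using g(1)
      proof (cases rule: proper_fun_cases[of _ v])
        case (2 r')
        have "0 \<le> ?a * (norm (v - w))\<^sup>2" using a by simp
        then show ?thesis using min'[OF 2] by (simp add: r 2 del: times_divide_eq_left)
      qed simp
    qed
  qed (auto intro: INF_lower)
  then show ?thesis
    using that[of r] prox r by simp
qed

section \<open>Convexity of the perturbation function\<close>

text \<open>Up to closure, this is the epigraph of \<open>p(u) = inf\<^sub>x f(x) + g(c(x) + u)\<close>.\<close>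

definition perturbation_epi ::
    "('a \<Rightarrow> real) \<Rightarrow> ('b::real_vector \<Rightarrow> ereal) \<Rightarrow> ('a \<Rightarrow> 'b) \<Rightarrow> ('b \<times> real) set" where
  "perturbation_epi f g c = {q. \<exists>x. ereal (f x) + g (c x + fst q) \<le> ereal (snd q)}"

text \<open>Convexity of \<open>g\<close> handles the combination \<open>?z\<close>. The convexity
  gap of \<open>c\<close> moves \<open>?z\<close> to an argument of the required form along a
  horizon direction, which does not increase \<open>g\<close>.\<close>

lemma convex_perturbation_epi:
  assumes f: "convex_on UNIV f" and g: "proper_fun g" "convex_fun g"
    and c: "cone_convex (uminus ` hzn g) c"
  shows "convex (perturbation_epi f g c)"
proof (rule convexI)
  fix p q and t s :: real
  assume pq: "p \<in> perturbation_epi f g c" "q \<in> perturbation_epi f g c"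
    and ts: "0 \<le> t" "0 \<le> s" "t + s = 1"
  have s: "s = 1 - t" "t \<le> 1"
    using ts by auto
  obtain x x' where x: "ereal (f x) + g (c x + fst p) \<le> ereal (snd p)"
      "ereal (f x') + g (c x' + fst q) \<le> ereal (snd q)"
    using pq by (auto simp: perturbation_epi_def)
  have gx: "g (c x + fst p) \<le> ereal (snd p - f x)" "g (c x' + fst q) \<le> ereal (snd q - f x')"
    using x by (cases "g (c x + fst p)"; cases "g (c x' + fst q)"; simp)+
  let ?x = "t *\<^sub>R x + s *\<^sub>R x'"
  let ?z = "t *\<^sub>R (c x + fst p) + s *\<^sub>R (c x' + fst q)"
  obtain v where v: "v \<in> hzn g" "t *\<^sub>R c x + s *\<^sub>R c x' - c ?x = - v"
    using c ts s by (fastforce simp: cone_convex_def)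
  have z: "g ?z \<le> ereal (t * (snd p - f x) + s * (snd q - f x'))"
    using convex_fun_combination_le[OF g(2) \<open>0 \<le> t\<close> \<open>t \<le> 1\<close> gx] s by simp
  \<comment> \<open>The real upper bound puts \<open>?z\<close> in \<open>edom g\<close>, the only
    place where \<open>hzn\<close> says anything.\<close>
  then have "g (?z + v) \<le> g ?z"
    using v(1) unfolding hzn_def edom_def
    by (metis (mono_tags, lifting) PInfty_neq_ereal(1) ereal_infty_less(1) ereal_infty_less_eq(1)
        mem_Collect_eq)
  moreover have "?z + v = c ?x + fst (t *\<^sub>R p + s *\<^sub>R q)"
    using v(2) by (simp add: algebra_simps)
  moreover have "f ?x \<le> t * f x + s * f x'"
    using f ts by (auto simp: convex_on_def)
  ultimately have "ereal (f ?x) + g (c ?x + fst (t *\<^sub>R p + s *\<^sub>R q))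
      \<le> ereal (t * f x + s * f x') + ereal (t * (snd p - f x) + s * (snd q - f x'))"
    using z by (intro add_mono) auto
  also have "\<dots> = ereal (snd (t *\<^sub>R p + s *\<^sub>R q))"
    by (simp add: algebra_simps)
  finally show "t *\<^sub>R p + s *\<^sub>R q \<in> perturbation_epi f g c"
    by (auto simp: perturbation_epi_def)
qed

section \<open>The dual and the augmented Lagrangian through perturbations\<close>

text \<open>This is the Fenchel-Young inequality at \<open>c x + fst q\<close>. For fixed
  \<open>y\<close> the bound is a closed condition on \<open>q\<close>, so it survives the closure,
  where the minimizer will lie.\<close>

lemma dual_fun_le_perturbation:
  fixes c :: "'a \<Rightarrow> 'b::euclidean_space"
  assumes g: "proper_fun g" and q: "q \<in> closure (perturbation_epi f g c)"
  shows "dual_fun f g c y \<le> ereal (snd q - y \<bullet> fst q)"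
proof -
  have "perturbation_epi f g c \<subseteq> {q. dual_fun f g c y \<le> ereal (snd q - y \<bullet> fst q)}"
  proof
    fix q assume "q \<in> perturbation_epi f g c"
    then obtain x where x: "ereal (f x) + g (c x + fst q) \<le> ereal (snd q)"
      by (auto simp: perturbation_epi_def)
    obtain r where r: "g (c x + fst q) = ereal r" "f x + r \<le> snd q"
      using g
    proof (cases rule: proper_fun_cases[of _ "c x + fst q"])
      case 1
      then show ?thesis using x by simp
    next
      case (2 r)
      then show ?thesis using x that by simp
    qed
    have "ereal (y \<bullet> (c x + fst q) - r) \<le> conj_fun g y"
      unfolding conj_fun_def by (rule SUP_upper2[of "c x + fst q"]) (simp_all add: r)
    then have "Lagr f g c x y \<le> ereal (snd q - y \<bullet> fst q)"
      unfolding Lagr_def using r(2) by (cases "conj_fun g y") (auto simp: inner_add_right)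
    then show "q \<in> {q. dual_fun f g c y \<le> ereal (snd q - y \<bullet> fst q)}"
      by (auto simp: dual_fun_def intro: INF_lower2)
  qed
  moreover have "closed {q :: 'b \<times> real. dual_fun f g c y \<le> ereal (snd q - y \<bullet> fst q)}"
    by (intro closed_Collect_le continuous_intros)
  ultimately show ?thesis
    using q closure_minimal by blast
qed

lemma dual_fun_ge_perturbation:
  assumes g: "proper_fun g"
    and K: "\<And>q. q \<in> perturbation_epi f g c \<Longrightarrow> K \<le> snd q - y \<bullet> fst q"
  shows "ereal K \<le> dual_fun f g c y"
  unfolding dual_fun_def
proof (rule INF_greatest)
  fix x
  have "conj_fun g y \<le> ereal (f x + y \<bullet> c x - K)"
    unfolding conj_fun_def
  proof (rule SUP_least)
    fix z
    show "ereal (y \<bullet> z) - g z \<le> ereal (f x + y \<bullet> c x - K)"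
      using g
    proof (cases rule: proper_fun_cases[of _ z])
      case (2 r)
      \<comment> \<open>The perturbation \<open>z - c x\<close> moves the argument of
        \<open>g\<close> from \<open>c x\<close> to \<open>z\<close>, so every \<open>z\<close> of
        finite value is covered.\<close>
      then have "(z - c x, f x + r) \<in> perturbation_epi f g c"
        by (auto simp: perturbation_epi_def intro: exI[of _ x])
      from K[OF this] show ?thesis
        by (simp add: 2 inner_diff_right)
    qed simp
  qed
  then show "ereal K \<le> Lagr f g c x y"
    unfolding Lagr_def by (cases "conj_fun g y") auto
qed

text \<open>Use \<open>c x + fst q\<close> as a competitor in the Moreau envelope;
  \<open>c x\<close> then cancels in the quadratic term.\<close>

lemma aug_Lagr_le_perturbation:
  fixes c :: "'a \<Rightarrow> 'b::real_inner"
  assumes "\<mu> > 0" "q \<in> perturbation_epi f g c"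
  obtains x where "aug_Lagr \<mu> f g c x y
    \<le> ereal (snd q + 1 / (2 * \<mu>) * (norm (fst q - \<mu> *\<^sub>R y))\<^sup>2 - \<mu> / 2 * (norm y)\<^sup>2)"
proof -
  obtain x where x: "ereal (f x) + g (c x + fst q) \<le> ereal (snd q)"
    using assms(2) by (auto simp: perturbation_epi_def)
  let ?n = "1 / (2 * \<mu>) * (norm (fst q - \<mu> *\<^sub>R y))\<^sup>2"
  have "moreau_env \<mu> g (c x + \<mu> *\<^sub>R y) \<le> g (c x + fst q) + ereal ?n"
    unfolding moreau_env_def by (rule INF_lower2[of "c x + fst q"]) (simp_all add: algebra_simps)
  then have "ereal (f x) + moreau_env \<mu> g (c x + \<mu> *\<^sub>R y) \<le> ereal (f x) + (g (c x + fst q) + ereal ?n)"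
    by (rule add_left_mono)
  also have "\<dots> = ereal (f x) + g (c x + fst q) + ereal ?n"
    by (simp add: add.assoc)
  also have "\<dots> \<le> ereal (snd q) + ereal ?n"
    using x by (rule add_right_mono)
  finally have "aug_Lagr \<mu> f g c x y \<le> ereal (snd q) + ereal ?n - ereal (\<mu> / 2 * (norm y)\<^sup>2)"
    unfolding aug_Lagr_def by (rule ereal_minus_mono) simp
  then show ?thesis
    by (intro that) simp
qed

text \<open>The optimality condition at \<open>p\<close> makes the multiplier \<open>ys\<close> the
  slope of a supporting hyperplane there. This fixes the dual value at \<open>ys\<close>, and
  \<open>p\<close> also gives an affine majorant of the dual function that touches it at
  \<open>ys\<close>.\<close>

lemma prox_dual_fun_eq:
  fixes c :: "'a \<Rightarrow> 'b::euclidean_space"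
  assumes g: "proper_fun g" and "\<mu> > 0" and p: "p \<in> closure (perturbation_epi f g c)"
    and min: "\<And>q. q \<in> perturbation_epi f g c \<Longrightarrow>
      snd p + 1 / (2 * \<mu>) * (norm (fst p - \<mu> *\<^sub>R y))\<^sup>2 + 1 / (2 * \<mu>) * (norm (fst q - fst p))\<^sup>2
        \<le> snd q + 1 / (2 * \<mu>) * (norm (fst q - \<mu> *\<^sub>R y))\<^sup>2"
  shows "prox (\<lambda>y. - (ereal (1 / \<mu>) * dual_fun f g c y)) y = y - inverse \<mu> *\<^sub>R fst p"
proof -
  define ys where "ys = y - inverse \<mu> *\<^sub>R fst p"
  \<comment> \<open>The gradient of the quadratic at \<open>fst p\<close> is \<open>- ys\<close>.
    The expansion is exact, and its remainder cancels the growth term of \<open>min\<close>.\<close>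
  have expand: "1 / (2 * \<mu>) * (norm (u - \<mu> *\<^sub>R y))\<^sup>2
      = 1 / (2 * \<mu>) * (norm (fst p - \<mu> *\<^sub>R y))\<^sup>2 + 1 / (2 * \<mu>) * (norm (u - fst p))\<^sup>2
        - ys \<bullet> u + ys \<bullet> fst p" for u
    using \<open>\<mu> > 0\<close> unfolding power2_norm_eq_inner ys_def
    by (simp add: inner_diff_left inner_diff_right inner_commute field_simps)
  let ?K = "snd p - ys \<bullet> fst p"
  have "?K \<le> snd q - ys \<bullet> fst q" if "q \<in> perturbation_epi f g c" for q
    using min[OF that] expand[of "fst q"] by linarith
  then have "ereal ?K \<le> dual_fun f g c ys"
    by (rule dual_fun_ge_perturbation[OF g])
  then have dual: "dual_fun f g c ys = ereal ?K"
    using dual_fun_le_perturbation[OF g p, of ys] by (rule antisym[rotated])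
  show ?thesis
    unfolding ys_def[symmetric]
  proof (rule prox_eqI)
    show "\<bar>- (ereal (1 / \<mu>) * dual_fun f g c ys)\<bar> \<noteq> \<infinity>"
      by (simp add: dual)
    fix v
    let ?D = "snd p - v \<bullet> fst p"
    have fst_p: "fst p = \<mu> *\<^sub>R (y - ys)"
      using \<open>\<mu> > 0\<close> by (simp add: ys_def)
    \<comment> \<open>With the affine majorant \<open>?D\<close> in place of the dual function, the
      proximal objective is a quadratic in \<open>v\<close> minimized at \<open>ys\<close>.\<close>
    have "- (?K / \<mu>) + (1 / 2 * (norm (ys - y))\<^sup>2 + 1 / 2 * (norm (v - ys))\<^sup>2)
        = - (?D / \<mu>) + 1 / 2 * (norm (v - y))\<^sup>2"
      using \<open>\<mu> > 0\<close> unfolding power2_norm_eq_inner fst_p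
      by (simp add: inner_diff_left inner_diff_right inner_commute field_simps)
    moreover have "- (ereal (1 / \<mu>) * ereal ?D) \<le> - (ereal (1 / \<mu>) * dual_fun f g c v)"
      using dual_fun_le_perturbation[OF g p, of v] \<open>\<mu> > 0\<close>
      by (simp only: ereal_minus_le_minus) (rule ereal_mult_left_mono, auto)
    then have "ereal (- (?D / \<mu>)) + ereal (1 / 2 * (norm (v - y))\<^sup>2)
        \<le> - (ereal (1 / \<mu>) * dual_fun f g c v) + ereal (1 / 2 * (norm (v - y))\<^sup>2)"
      by (intro add_right_mono) simp
    ultimately show "- (ereal (1 / \<mu>) * dual_fun f g c ys)
          + ereal (1 / 2 * (norm (ys - y))\<^sup>2 + 1 / 2 * (norm (v - ys))\<^sup>2)
        \<le> - (ereal (1 / \<mu>) * dual_fun f g c v) + ereal (1 / 2 * (norm (v - y))\<^sup>2)"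
      by (simp add: dual)
  qed
qed

section \<open>From primal inexactness to the dual error\<close>

theorem theorem4p4:
  fixes f :: "real ^ 'n \<Rightarrow> real"
    and g :: "real ^ 'm \<Rightarrow> ereal"
    and c :: "real ^ 'n \<Rightarrow> real ^ 'm"
    and xbar :: "real ^ 'n"
    and yhat ybar zbar :: "real ^ 'm"
    and \<mu> \<epsilon> :: real
  assumes "continuously_differentiable f" and "convex_on UNIV f"
    and "proper_fun g" and "lsc_fun g" and "convex_fun g"
    and "continuously_differentiable c" and "cone_convex (uminus ` hzn g) c"
    and "\<exists>x. c x \<in> edom g"
    and "\<exists>x. \<forall>x'. Phi f g c x \<le> Phi f g c x'"
    and "\<mu> > 0" and "\<epsilon> \<ge> 0"
    and "aug_Lagr \<mu> f g c xbar yhat \<le> (INF x. aug_Lagr \<mu> f g c x yhat) + ereal \<epsilon>"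
    and "zbar = prox (\<lambda>w. ereal \<mu> * g w) (c xbar + \<mu> *\<^sub>R yhat)"
    and "ybar = yhat + inverse \<mu> *\<^sub>R (c xbar - zbar)"
  shows "ybar \<in> inexact_prox (1 / \<mu>) (\<lambda>y. - dual_fun f g c y) \<epsilon> yhat \<and>
         norm (ybar - prox (\<lambda>y. - (ereal (1 / \<mu>) * dual_fun f g c y)) yhat) \<le> sqrt (2 * \<epsilon> / \<mu>)"
proof -
  let ?S = "perturbation_epi f g c"
  let ?a = "1 / (2 * \<mu>)"
  let ?Q = "\<lambda>q. snd q + ?a * (norm (fst q - \<mu> *\<^sub>R yhat))\<^sup>2"
  note g = assms(3-5) and \<mu> = \<open>\<mu> > 0\<close>
  obtain r where r: "g zbar = ereal r"
    "moreau_env \<mu> g (c xbar + \<mu> *\<^sub>R yhat) = ereal (r + ?a * (norm (zbar - (c xbar + \<mu> *\<^sub>R yhat)))\<^sup>2)"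
    using prox_minimizes[OF g \<mu>, of "c xbar + \<mu> *\<^sub>R yhat"] unfolding assms(13) by metis
  \<comment> \<open>The perturbation that attains the Moreau envelope at \<open>xbar\<close>; hence
    \<open>?Q qbar\<close> is the augmented Lagrangian up to a constant.\<close>
  define qbar where "qbar = (zbar - c xbar, f xbar + r)"
  have qbar: "qbar \<in> ?S"
    by (auto simp: perturbation_epi_def qbar_def r intro: exI[of _ xbar])
  have aug: "aug_Lagr \<mu> f g c xbar yhat = ereal (?Q qbar - \<mu> / 2 * (norm yhat)\<^sup>2)"
    by (simp add: aug_Lagr_def r qbar_def algebra_simps)
  have lower: "?Q qbar - \<epsilon> \<le> ?Q q" if q: "q \<in> ?S" for q
  proof -
    obtain x where x: "aug_Lagr \<mu> f g c x yhat \<le> ereal (?Q q - \<mu> / 2 * (norm yhat)\<^sup>2)"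
      using aug_Lagr_le_perturbation[OF \<mu> q] by blast
    have "aug_Lagr \<mu> f g c xbar yhat \<le> (INF x. aug_Lagr \<mu> f g c x yhat) + ereal \<epsilon>"
      by fact
    also have "\<dots> \<le> ereal (?Q q - \<mu> / 2 * (norm yhat)\<^sup>2) + ereal \<epsilon>"
      using x by (intro add_right_mono INF_lower2[where i = x]) auto
    finally show ?thesis
      by (simp add: aug)
  qed
  have "?S \<subseteq> {q. ?Q qbar - \<epsilon> \<le> ?Q q}"
    using lower by blast
  moreover have "closed {q. ?Q qbar - \<epsilon> \<le> ?Q q}"
    by (intro closed_Collect_le continuous_intros)
  \<comment> \<open>On the closure this bound serves twice: it makes the minimization well posed and
    it limits how far \<open>qbar\<close> is from optimal.\<close>
  ultimately have lower': "?Q qbar - \<epsilon> \<le> ?Q q" if "q \<in> closure ?S" for q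
    using that closure_minimal by blast
  have a: "?a > 0" using \<mu> by simp
  have cvx: "convex (closure ?S)"
    using convex_perturbation_epi assms by (blast intro: convex_closure)
  have ne: "closure ?S \<noteq> {}"
    using qbar by auto
  obtain p where p: "p \<in> closure ?S"
    and min: "\<And>q. q \<in> closure ?S \<Longrightarrow> ?Q p + ?a * (norm (fst q - fst p))\<^sup>2 \<le> ?Q q"
    using convex_set_proximal_minimizer[OF closed_closure cvx ne a lower'] by blast
  have prox: "prox (\<lambda>y. - (ereal (1 / \<mu>) * dual_fun f g c y)) yhat = yhat - inverse \<mu> *\<^sub>R fst p"
    using min closure_subset by (intro prox_dual_fun_eq[OF g(1) \<mu> p]) blast
  \<comment> \<open>Growth at \<open>p\<close> meets near-optimality: \<open>?Q p\<close> plus this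
    term is at most \<open>?Q qbar\<close>, which is at most
    \<open>?Q p + \<epsilon>\<close>.\<close>
  have "?a * (norm (fst qbar - fst p))\<^sup>2 \<le> \<epsilon>"
    using lower'[OF p] min[of qbar] qbar closure_subset by fastforce
  then have le: "(norm (fst qbar - fst p))\<^sup>2 \<le> 2 * \<mu> * \<epsilon>"
    using \<mu> by (simp add: field_simps)
  \<comment> \<open>Both multipliers are \<open>yhat\<close> minus a perturbation divided by
    \<open>\<mu>\<close>, so squared distances shrink by \<open>\<mu>\<close> squared.\<close>
  have "ybar - (yhat - inverse \<mu> *\<^sub>R fst p) = - inverse \<mu> *\<^sub>R (fst qbar - fst p)"
    unfolding assms(14) by (simp add: qbar_def algebra_simps)
  then have "(norm (ybar - (yhat - inverse \<mu> *\<^sub>R fst p)))\<^sup>2 = (norm (fst qbar - fst p))\<^sup>2 / \<mu>\<^sup>2"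
    by (simp only: norm_scaleR power_mult_distrib abs_minus power2_abs) (simp add: field_simps)
  also have "\<dots> \<le> 2 * \<mu> * \<epsilon> / \<mu>\<^sup>2"
    using le by (rule divide_right_mono) simp
  also have "\<dots> = 2 * \<epsilon> / \<mu>"
    using \<mu> by (simp add: power2_eq_square)
  finally have "norm (ybar - prox (\<lambda>y. - (ereal (1 / \<mu>) * dual_fun f g c y)) yhat) \<le> sqrt (2 * \<epsilon> / \<mu>)"
    unfolding prox by (rule real_le_rsqrt)
  then show ?thesis
    by (simp add: inexact_prox_def)
qed

end
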